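(* Let $k$ be a positive integer and $p$ an integer with $0\le p\le k-1$. For all integers $n\ge 1$, (1) $a_k(n)=k\,b_k(n)$, and (2) $a_{k,p}(n)=(k-p)\,b_k(n-p)+p\,b_k(n+k-p)$.
   Context: A partition of a positive integer $n$ is a weakly decreasing finite sequence of positive integers (parts) summing to $n$. For a positive integer $n$: $a_k(n)$ is the sum, over all partitions $\lambda$ of $n$, of the sum of the distinct part values of $\lambda$ that are divisible by $k$ (each distinct value counted once per partition); $a_{k,p}(n)$ is the sum, over all partitions $\lambda$ of $n$, of the sum of the distinct part values of $\lambda$ congruent to $p\pmod k$ (each counted once per partition); $b_k(n)$ is the sum, over all partitions $\lambda$ of $n$, of the sum of the distinct part values of $\lambda$ that appear at least $k$ times in $\lambda$. Convention: $b_k(m)=0$ for integers $m\le 0$. *)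

theory Defs
  imports Main "HOL-Number_Theory.Cong"
begin

definition partitions :: "nat \<Rightarrow> nat list set" where
  "partitions n = {xs. sorted_wrt (\<ge>) xs \<and> (\<forall>x\<in>set xs. 0 < x) \<and> sum_list xs = n}"

(* Sums over an infinite set would silently be 0; the following lemma rules this out. *)
lemma finite_partitions: "finite (partitions n)"
proof -
  have len: "length xs \<le> sum_list xs" if "\<forall>x\<in>set xs. 0 < x" for xs :: "nat list"
    using that by (induction xs) auto
  have "partitions n \<subseteq> {xs. set xs \<subseteq> {..n} \<and> length xs \<le> n}"
    using len member_le_sum_list by (fastforce simp: partitions_def)
  then show ?thesis
    by (rule finite_subset) (simp add: finite_lists_length_le)
qed

definition a_div :: "nat \<Rightarrow> nat \<Rightarrow> nat" where
  "a_div k n = (\<Sum>xs\<in>partitions n. \<Sum>x | x \<in> set xs \<and> k dvd x. x)"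

definition a_cong :: "nat \<Rightarrow> int \<Rightarrow> nat \<Rightarrow> nat" where
  "a_cong k p n = (\<Sum>xs\<in>partitions n. \<Sum>x | x \<in> set xs \<and> [int x = p] (mod int k). x)"

(* The argument m is an integer so that the convention b_k(m) = 0 for m \<le> 0 can be stated. *)
definition b_mult :: "nat \<Rightarrow> int \<Rightarrow> nat" where
  "b_mult k m = (if m \<le> 0 then 0
     else \<Sum>xs\<in>partitions (nat m). \<Sum>x | x \<in> set xs \<and> k \<le> count_list xs x. x)"

end

theory Submission
  imports Defs "HOL-Library.Multiset"
begin

text \<open>Deleting \<open>j\<close> copies of \<open>x\<close> shows that a number \<open>n\<close> has as many partitions containing \<open>x\<close>
  at least \<open>j\<close> times as \<open>n - j x\<close> has partitions. With \<open>P\<close> the partition function, this gives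
  \<open>b\<^sub>k(n) = \<Sum>m. m P(n - k m)\<close>, while the parts congruent to \<open>p\<close> contribute
  \<open>\<Sum>m. (k m + p) P(n - p - k m)\<close>. Now split \<open>k m + p = (k - p) m + p (m + 1)\<close> and shift the
  index in the second sum. The first identity is the case \<open>p = 0\<close>.\<close>

text \<open>With multisets, inserting or deleting copies of a part is plain addition or subtraction,
  and no order has to be restored.\<close>

definition mset_partitions :: "nat \<Rightarrow> nat multiset set" where
  "mset_partitions n = {M. 0 \<notin># M \<and> sum_mset M = n}"

lemma bij_betw_mset_partitions: "bij_betw mset (partitions n) (mset_partitions n)"
proof (rule bij_betw_imageI)
  show "inj_on mset (partitions n)"
  proof (rule inj_onI)
    fix xs ys assume xs: "xs \<in> partitions n" and ys: "ys \<in> partitions n" and eq: "mset xs = mset ys"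
    have "sorted (rev xs)" "sorted (rev ys)"
      using xs ys by (simp_all add: partitions_def sorted_wrt_rev)
    moreover have "mset (rev xs) = mset (rev ys)"
      using eq by simp
    ultimately have "rev xs = rev ys"
      by (metis properties_for_sort)
    then show "xs = ys" by simp
  qed
  show "mset ` partitions n = mset_partitions n"
  proof (intro equalityI subsetI)
    fix M assume "M \<in> mset ` partitions n"
    then show "M \<in> mset_partitions n"
      by (auto simp: partitions_def mset_partitions_def sum_mset_sum_list)
  next
    fix M assume M: "M \<in> mset_partitions n"
    define xs where "xs = rev (sorted_list_of_multiset M)"
    have xs: "mset xs = M" by (simp add: xs_def)
    have "sorted_wrt (\<ge>) xs" by (simp add: xs_def sorted_wrt_rev)
    moreover have "\<forall>x\<in>set xs. 0 < x"
      using M xs by (auto simp: mset_partitions_def intro!: gr0I)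
    moreover have "sum_list xs = n"
      using M xs by (metis (mono_tags, lifting) mem_Collect_eq mset_partitions_def sum_mset_sum_list)
    ultimately show "M \<in> mset ` partitions n"
      using xs by (auto simp: partitions_def)
  qed
qed

lemma card_partitions_count_ge_mset:
  "card {xs \<in> partitions n. j \<le> count_list xs x} = card {M \<in> mset_partitions n. j \<le> count M x}"
proof (rule bij_betw_same_card)
  show "bij_betw mset {xs \<in> partitions n. j \<le> count_list xs x} {M \<in> mset_partitions n. j \<le> count M x}"
  proof (rule bij_betw_subset[OF bij_betw_mset_partitions])
    have "mset_partitions n = mset ` partitions n"
      using bij_betw_imp_surj_on[OF bij_betw_mset_partitions] by simp
    then show "mset ` {xs \<in> partitions n. j \<le> count_list xs x}
        = {M \<in> mset_partitions n. j \<le> count M x}"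
      by (auto simp: count_mset)
  qed auto
qed

text \<open>The integer argument avoids truncated subtraction: deleting more than \<open>n\<close>
  gives 0, whereas the argument 0 gives 1, for the empty partition.\<close>

definition partition_number :: "int \<Rightarrow> nat" where
  "partition_number m = (if m < 0 then 0 else card (partitions (nat m)))"

lemma sum_mset_ge_count_mult: "count M x * x \<le> sum_mset (M :: nat multiset)"
proof -
  have "replicate_mset (count M x) x \<subseteq># M"
    by (simp add: count_le_replicate_mset_subset_eq[symmetric])
  then have "sum_mset (replicate_mset (count M x) x) \<le> sum_mset M"
    by (metis le_add1 subset_mset.add_diff_inverse sum_mset.union)
  then show ?thesis by simp
qed

text \<open>Adding \<open>j\<close> copies of \<open>x\<close> inverts the deletion;
  \<open>0 < x\<close> ensures that the result still has only positive parts. If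
  \<open>j * x\<close> exceeds \<open>n\<close>, those copies alone are too large and both sides are
  0.\<close>

lemma card_partitions_count_ge:
  assumes "0 < x"
  shows "card {xs \<in> partitions n. j \<le> count_list xs x} = partition_number (int n - int (j * x))"
proof (cases "j * x \<le> n")
  case True
  have "bij_betw (\<lambda>M. M + replicate_mset j x) (mset_partitions (n - j * x))
    {M \<in> mset_partitions n. j \<le> count M x}"
  proof (rule bij_betw_byWitness[where f' = "\<lambda>M. M - replicate_mset j x"])
    show "\<forall>M\<in>{M \<in> mset_partitions n. j \<le> count M x}.
        M - replicate_mset j x + replicate_mset j x = M"
      by (simp add: count_le_replicate_mset_subset_eq)
    show "(\<lambda>M. M + replicate_mset j x) ` mset_partitions (n - j * x)
        \<subseteq> {M \<in> mset_partitions n. j \<le> count M x}"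
      using True assms by (auto simp: mset_partitions_def split: if_splits)
    show "(\<lambda>M. M - replicate_mset j x) ` {M \<in> mset_partitions n. j \<le> count M x}
        \<subseteq> mset_partitions (n - j * x)"
      by (auto simp: mset_partitions_def count_le_replicate_mset_subset_eq sum_mset_diff
          dest: in_diffD)
  qed simp
  then have "card {M \<in> mset_partitions n. j \<le> count M x} = card (mset_partitions (n - j * x))"
    by (simp add: bij_betw_same_card)
  also have "\<dots> = card (partitions (n - j * x))"
    using bij_betw_same_card[OF bij_betw_mset_partitions] by simp
  also have "\<dots> = partition_number (int n - int (j * x))"
    using True by (simp add: partition_number_def nat_diff_distrib' flip: of_nat_mult of_nat_diff)
  finally show ?thesis
    by (simp add: card_partitions_count_ge_mset)
next
  case False
  have "\<not> j \<le> count M x" if "M \<in> mset_partitions n" for M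
  proof
    assume "j \<le> count M x"
    then have "j * x \<le> count M x * x" by (rule mult_le_mono1)
    also have "\<dots> \<le> n" using that sum_mset_ge_count_mult[of M x] by (simp add: mset_partitions_def)
    finally show False using False by simp
  qed
  then have empty: "{M \<in> mset_partitions n. j \<le> count M x} = {}" by blast
  then show ?thesis
    using False by (simp add: card_partitions_count_ge_mset empty partition_number_def flip: of_nat_mult)
qed

text \<open>Double counting: exchange the sum over partitions with the sum over part values. Values
  between \<open>n\<close> and \<open>N\<close> contribute 0, so the range can be chosen freely. The
  case \<open>j = k\<close> with trivial \<open>C\<close> serves \<open>b_mult\<close>; the case
  \<open>j = 1\<close> with a residue condition serves \<open>a_cong\<close>.\<close>

lemma sum_parts_count_ge:
  assumes "1 \<le> j" and "n \<le> N"
  shows "(\<Sum>xs\<in>partitions n. \<Sum>x | x \<in> set xs \<and> C x \<and> j \<le> count_list xs x. x)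
    = (\<Sum>x | x \<le> N \<and> C x. x * partition_number (int n - int (j * x)))"
proof -
  have part_le: "x \<le> N" if "xs \<in> partitions n" "x \<in> set xs" for xs x
    using that assms member_le_sum_list[of x xs] by (auto simp: partitions_def)
  have "(\<Sum>xs\<in>partitions n. \<Sum>x | x \<in> set xs \<and> C x \<and> j \<le> count_list xs x. x)
    = (\<Sum>xs\<in>partitions n. \<Sum>x | x \<in> {x. x \<le> N \<and> C x} \<and> j \<le> count_list xs x. x)"
  proof (intro sum.cong refl)
    fix xs assume xs: "xs \<in> partitions n"
    have "x \<in> set xs" if "j \<le> count_list xs x" for x
      using that assms(1) count_list_0_iff[of xs x] by auto
    then show "{x. x \<in> set xs \<and> C x \<and> j \<le> count_list xs x}
        = {x. x \<in> {x. x \<le> N \<and> C x} \<and> j \<le> count_list xs x}"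
      using part_le[OF xs] by auto
  qed
  also have "\<dots> = (\<Sum>x | x \<le> N \<and> C x. \<Sum>xs | xs \<in> partitions n \<and> j \<le> count_list xs x. x)"
    by (rule sum.swap_restrict) (simp_all add: finite_partitions)
  also have "\<dots> = (\<Sum>x | x \<le> N \<and> C x. x * partition_number (int n - int (j * x)))"
  proof (intro sum.cong refl)
    fix x
    show "(\<Sum>xs | xs \<in> partitions n \<and> j \<le> count_list xs x. x)
        = x * partition_number (int n - int (j * x))"
      \<comment> \<open>The counting lemma requires a positive part; at \<open>x = 0\<close> the
        weight \<open>x\<close> makes both sides vanish.\<close>
      using card_partitions_count_ge[of x n j] by (cases "x = 0") auto
  qed
  finally show ?thesis .
qed

text \<open>The convention for \<open>m \<le> 0\<close> agrees with the formula: the term at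
  \<open>x = 0\<close> has weight 0, and every other term has a negative argument.\<close>

lemma b_mult_eq_sum:
  assumes "1 \<le> k" and "m \<le> int N"
  shows "b_mult k m = (\<Sum>x\<le>N. x * partition_number (m - int (k * x)))"
proof (cases "m \<le> 0")
  case True
  have "x * partition_number (m - int (k * x)) = 0" for x
  proof (cases "x = 0")
    case False
    then have "0 < int (k * x)" using assms(1) by simp
    then show ?thesis using True by (simp add: partition_number_def)
  qed simp
  then show ?thesis using True by (simp add: b_mult_def)
next
  case False
  have "{x. x \<le> N \<and> True} = {..N}" by auto
  then show ?thesis
    using False assms sum_parts_count_ge[of k "nat m" N "\<lambda>_. True"] by (simp add: b_mult_def)
qed

lemma a_cong_eq_sum:
  assumes "q < k" and "n \<le> N"
  shows "a_cong k (int q) n = (\<Sum>m\<le>N. (k * m + q) * partition_number (int n - int (k * m + q)))"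
proof -
  have cong: "[int x = int q] (mod int k) \<longleftrightarrow> x mod k = q" for x
    using assms by (simp add: cong_def flip: of_nat_mod)
  have count: "x \<in> set xs \<longleftrightarrow> 1 \<le> count_list xs x" for x and xs :: "nat list"
    using count_list_0_iff[of xs x] by auto
  \<comment> \<open>This bound closes a full block of residues, so the values up to it in the class
    of \<open>q\<close> are exactly \<open>k * m + q\<close> with \<open>m \<le> N\<close>.\<close>
  have "n \<le> k * N + (k - 1)"
    using assms by (metis One_nat_def le_add1 le_trans less_nat_zero_code mult_le_mono1 nat_mult_1
        not_less_eq_eq not_gr_zero Suc_leI)
  then have "a_cong k (int q) n
      = (\<Sum>x | x \<le> k * N + (k - 1) \<and> x mod k = q. x * partition_number (int n - int x))"
    using sum_parts_count_ge[of 1 n "k * N + (k - 1)" "\<lambda>x. x mod k = q"]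
    unfolding a_cong_def cong by (simp add: count conj_commute conj_left_commute)
  also have "{x. x \<le> k * N + (k - 1) \<and> x mod k = q} = (\<lambda>m. k * m + q) ` {..N}"
  proof (intro equalityI subsetI)
    fix x assume x: "x \<in> {x. x \<le> k * N + (k - 1) \<and> x mod k = q}"
    then have "x < k * Suc N" using assms(1) by (simp; linarith)
    then have "x div k \<le> N" by (simp add: less_mult_imp_div_less mult.commute flip: less_Suc_eq_le)
    moreover have "x = k * (x div k) + q" using x mult_div_mod_eq[of k x] by simp
    ultimately show "x \<in> (\<lambda>m. k * m + q) ` {..N}" by blast
  next
    fix x assume "x \<in> (\<lambda>m. k * m + q) ` {..N}"
    then obtain m where m: "m \<le> N" "x = k * m + q" by blast
    then have "x \<le> k * N + (k - 1)"
      using assms(1) add_mono[OF mult_le_mono2[OF m(1), of k], of q "k - 1"] by simp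
    then show "x \<in> {x. x \<le> k * N + (k - 1) \<and> x mod k = q}"
      using m(2) assms(1) by simp
  qed
  also have "(\<Sum>x\<in>\<dots>. x * partition_number (int n - int x))
      = (\<Sum>m\<le>N. (k * m + q) * partition_number (int n - int (k * m + q)))"
    using assms(1) by (subst sum.reindex) (auto simp: inj_on_def)
  finally show ?thesis .
qed

lemma a_cong_eq_b_mult:
  assumes "q < k"
  shows "a_cong k (int q) n
    = (k - q) * b_mult k (int n - int q) + q * b_mult k (int n + int k - int q)"
proof -
  \<comment> \<open>Large enough for all three sums, so that they can be compared term by
    term.\<close>
  define N where "N = n + k"
  define P where "P m = partition_number (int n - int (k * m + q))" for m
  have b1: "b_mult k (int n - int q) = (\<Sum>m\<le>N. m * P m)"
    using assms by (subst b_mult_eq_sum[of _ _ N]) (auto simp: N_def P_def algebra_simps)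
  have "b_mult k (int n + int k - int q)
      = (\<Sum>m\<le>Suc N. m * partition_number (int n + int k - int q - int (k * m)))"
    using assms by (subst b_mult_eq_sum[of _ _ "Suc N"]) (auto simp: N_def)
  \<comment> \<open>The term at 0 has weight 0; replacing \<open>m\<close> by \<open>Suc m\<close>
    absorbs the extra \<open>k\<close> in the argument and leaves \<open>P m\<close>.\<close>
  also have "\<dots> = (\<Sum>m\<le>N. Suc m * P m)"
    by (subst sum.atMost_Suc_shift) (simp add: P_def algebra_simps)
  finally have b2: "b_mult k (int n + int k - int q) = (\<Sum>m\<le>N. Suc m * P m)" .
  have "k * m + q = (k - q) * m + q * Suc m" for m
    using assms by (simp add: diff_mult_distrib)
  then have "a_cong k (int q) n = (\<Sum>m\<le>N. ((k - q) * m + q * Suc m) * P m)"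
    using a_cong_eq_sum[OF assms, of n N] by (simp only: N_def P_def le_add1)
  then show ?thesis
    by (simp only: b1 b2 sum_distrib_left sum.distrib add_mult_distrib mult.assoc)
qed

theorem theorem2p2:
  fixes k n :: nat and p :: int
  assumes "k \<ge> 1" and "0 \<le> p" and "p \<le> int k - 1" and "n \<ge> 1"
  shows "a_div k n = k * b_mult k (int n) \<and>
    int (a_cong k p n) =
      (int k - p) * int (b_mult k (int n - p)) + p * int (b_mult k (int n + int k - p))"
proof
  \<comment> \<open>Divisibility by \<open>k\<close> is the residue class 0, for which the second
    summand carries the factor 0.\<close>
  have "a_div k n = a_cong k (int 0) n"
    by (simp add: a_div_def a_cong_def cong_0_iff)
  then show "a_div k n = k * b_mult k (int n)"
    using assms(1) a_cong_eq_b_mult[of 0 k n] by simp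
  obtain q where q: "p = int q" using assms(2) nonneg_int_cases by blast
  then have "q < k" using assms(3) by simp
  then show "int (a_cong k p n) =
      (int k - p) * int (b_mult k (int n - p)) + p * int (b_mult k (int n + int k - p))"
    using a_cong_eq_b_mult[of q k n] by (simp add: q of_nat_diff)
qed

end
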